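(* Let $M$ be a manifold with boundary $\partial M$. (a) If $\partial M$ is strongly collared in $M$, then $\partial M$ is a $0$-set in $M$. (b) If $M-\partial M$ is metrisable, then $\partial M$ is a $0$-set in $M$. (c) If $\partial M$ is collared in $M$, then $\partial M$ is a $G_\delta$ set in $M$.
   Context: Manifolds are NOT assumed metrisable, second countable, paracompact, or connected. A manifold (of dimension $n\ge 1$, $n$ fixed) is a Hausdorff space each of whose points has a neighborhood homeomorphic to $\mathbb{R}^{n-1}\times\mathbb{R}_{\ge 0}$. The boundary $\partial M$ is the set of points that do not have a neighborhood homeomorphic to $\mathbb{R}^n$; it is a closed subset of $M$ and is itself an $(n-1)$-manifold without boundary. A closed subset $B$ of a space $X$ is collared in $X$ if there is an embedding (homeomorphism onto its image) $h:B\times[0,1]\to X$ with $h(x,0)=x$ for all $x\in B$, $h^{-1}(B)=B\times\{0\}$, and $h(B\times[0,1))$ open in $X$. It is strongly collared in $X$ if moreover $h$ can be chosen to be a closed embedding. A $0$-set in a space is the inverse image of $\{0\}$ under a continuous real-valued function defined on the whole space. A $G_\delta$ set is a countable intersection of open sets. *)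

theory Defs
  imports "HOL-Analysis.Analysis"
begin

text \<open>Neighbourhoods are not required to be open. This matters for \<open>manifold\<close>: an interior point
  has a neighbourhood homeomorphic to the half-space, but it need not have an open one.\<close>

definition neighbourhood_in :: "'a topology \<Rightarrow> 'a \<Rightarrow> 'a set \<Rightarrow> bool" where
  "neighbourhood_in X x N \<longleftrightarrow>
     N \<subseteq> topspace X \<and> (\<exists>U. openin X U \<and> x \<in> U \<and> U \<subseteq> N)"

text \<open>The model space of dimension \<open>n\<close> with boundary; meaningful for \<open>n \<ge> 1\<close> only.\<close>

definition half_space :: "nat \<Rightarrow> ((nat \<Rightarrow> real) \<times> real) topology" where
  "half_space n = prod_topology (Euclidean_space (n - 1)) (top_of_set {0..})"

text \<open>No countability, metrisability or connectedness is assumed.\<close>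

definition manifold :: "nat \<Rightarrow> 'a topology \<Rightarrow> bool" where
  "manifold n M \<longleftrightarrow> Hausdorff_space M \<and>
     (\<forall>x \<in> topspace M. \<exists>N. neighbourhood_in M x N \<and> subtopology M N homeomorphic_space half_space n)"

definition manifold_boundary :: "nat \<Rightarrow> 'a topology \<Rightarrow> 'a set" where
  "manifold_boundary n M =
     {x \<in> topspace M. \<nexists>N. neighbourhood_in M x N \<and> subtopology M N homeomorphic_space Euclidean_space n}"

abbreviation collar_domain :: "'a topology \<Rightarrow> 'a set \<Rightarrow> ('a \<times> real) topology" where
  "collar_domain X B \<equiv> prod_topology (subtopology X B) (top_of_set {0..1})"

definition is_collar :: "'a topology \<Rightarrow> 'a set \<Rightarrow> ('a \<times> real \<Rightarrow> 'a) \<Rightarrow> bool" where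
  "is_collar X B h \<longleftrightarrow>
     embedding_map (collar_domain X B) X h \<and>
     (\<forall>x \<in> B. h (x, 0) = x) \<and>
     {p \<in> B \<times> {0..1}. h p \<in> B} = B \<times> {0} \<and>
     openin X (h ` (B \<times> {0..<1}))"

definition collared_in :: "'a topology \<Rightarrow> 'a set \<Rightarrow> bool" where
  "collared_in X B \<longleftrightarrow> closedin X B \<and> (\<exists>h. is_collar X B h)"

definition strongly_collared_in :: "'a topology \<Rightarrow> 'a set \<Rightarrow> bool" where
  "strongly_collared_in X B \<longleftrightarrow>
     closedin X B \<and> (\<exists>h. is_collar X B h \<and> closed_map (collar_domain X B) X h)"

definition zero_set_in :: "'a topology \<Rightarrow> 'a set \<Rightarrow> bool" where
  "zero_set_in X S \<longleftrightarrow>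
     (\<exists>f. continuous_map X euclideanreal f \<and> S = {x \<in> topspace X. f x = 0})"

end

theory Submission
  imports Defs
begin

text \<open>
  A collar \<open>h\<close> of \<open>B\<close> gives the open sets \<open>h(B \<times> [0,1/m))\<close>, which intersect in \<open>B\<close>; if \<open>h\<close> is closed,
  the collar parameter extends by \<open>1\<close> to a continuous function on the whole space.

  For part (b), the interior \<open>N\<close> is metrisable and locally separable, so each of its components \<open>C\<close>
  is separable, hence Lindelof. As \<open>M\<close> is locally compact Hausdorff and so completely regular, \<open>C\<close> is
  the set where some continuous \<open>f\<^sub>C\<close> on \<open>M\<close> does not vanish. No countability of the set of components
  is needed to glue the \<open>f\<^sub>C\<close>: a small box \<open>W\<close> around any point of \<open>M\<close> has \<open>W - \<partial>M\<close> connected, being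
  between an open box of interior points and its closure. So \<open>W\<close> meets at most one component, and the
  function that is \<open>f\<^sub>C\<close> on each \<open>C\<close> and \<open>0\<close> on \<open>\<partial>M\<close> agrees on \<open>W\<close> with a single \<open>f\<^sub>C\<close>. This also avoids
  invariance of domain.
\<close>

subsection \<open>Collars\<close>

text \<open>Closedness of \<open>h\<close> makes the collar image closed, and the image of the
  half-open collar is open by definition. The collar image and the complement of its half-open part
  therefore form a closed cover, on which the collar parameter and the constant 1 are
  pasted.\<close>

lemma zero_set_in_closed_collar:
  assumes B: "B \<subseteq> topspace X" and h: "is_collar X B h"
    and cl: "closed_map (collar_domain X B) X h"
  shows "zero_set_in X B"
proof -
  let ?D = "B \<times> {0..1::real}"
  have D: "topspace (collar_domain X B) = ?D"
    using B by auto
  have h0: "\<And>x. x \<in> B \<Longrightarrow> h (x, 0) = x"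
    and op: "openin X (h ` (B \<times> {0..<1}))"
    and hom: "homeomorphic_map (collar_domain X B) (subtopology X (h ` ?D)) h"
    using h unfolding is_collar_def embedding_map_def D by blast+
  obtain k where "homeomorphic_maps (collar_domain X B) (subtopology X (h ` ?D)) h k"
    using hom homeomorphic_map_maps by blast
  then have k: "continuous_map (subtopology X (h ` ?D)) (collar_domain X B) k"
    and kh: "\<And>p. p \<in> ?D \<Longrightarrow> k (h p) = p"
    unfolding homeomorphic_maps_def D by blast+
  have clo: "closedin X (h ` ?D)"
    using cl D unfolding closed_map_def by (metis closedin_topspace)
  \<comment> \<open>The value 1 off the collar matches the parameter at the outer end of the
    collar.\<close>
  define f where "f x = (if x \<in> h ` ?D then snd (k x) else 1)" for x
  have "continuous_map X euclideanreal f"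
  proof (rule pasting_lemma_closed)
    show "closedin X (if b then h ` ?D else topspace X - h ` (B \<times> {0..<1}))" for b
      using clo op by auto
    have "continuous_map (subtopology X (h ` ?D)) (top_of_set {0..1}) (snd \<circ> k)"
      using k by (rule continuous_map_compose) (rule continuous_map_snd)
    then show "continuous_map (subtopology X (if b then h ` ?D else topspace X - h ` (B \<times> {0..<1})))
        euclideanreal (if b then snd \<circ> k else (\<lambda>_. 1))" for b
      using continuous_map_in_subtopology by auto
    fix i j x
    assume "x \<in> topspace X \<inter> (if i then h ` ?D else topspace X - h ` (B \<times> {0..<1})) \<inter>
        (if j then h ` ?D else topspace X - h ` (B \<times> {0..<1}))"
    moreover have "snd (k x) = 1" if "x \<in> h ` ?D" "x \<notin> h ` (B \<times> {0..<1})"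
      using that by (force simp: kh less_le)
    ultimately show "(if i then snd \<circ> k else (\<lambda>_. 1)) x = (if j then snd \<circ> k else (\<lambda>_. 1)) x"
      by (auto split: if_splits)
  next
    fix x assume x: "x \<in> topspace X"
    have "h ` (B \<times> {0..<1}) \<subseteq> h ` ?D"
      by (intro image_mono) auto
    then show "\<exists>b. b \<in> UNIV \<and> x \<in> (if b then h ` ?D else topspace X - h ` (B \<times> {0..<1})) \<and>
        f x = (if b then snd \<circ> k else (\<lambda>_. 1)) x"
      using x by (intro exI[of _ "x \<in> h ` ?D"]) (auto simp: f_def)
  qed simp
  moreover have "B = {x \<in> topspace X. f x = 0}"
  proof (intro subset_antisym subsetI)
    fix x assume x: "x \<in> B"
    then have "x = h (x, 0)" "(x, 0) \<in> ?D"
      using h0 by auto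
    then show "x \<in> {x \<in> topspace X. f x = 0}"
      using B x kh[of "(x, 0)"] by (auto simp: f_def)
  next
    fix x assume "x \<in> {x \<in> topspace X. f x = 0}"
    then obtain p where "p \<in> ?D" "x = h p" "snd p = 0"
      by (auto simp: f_def kh split: if_splits)
    then show "x \<in> B"
      using h0 by auto
  qed
  ultimately show ?thesis
    unfolding zero_set_in_def by blast
qed

text \<open>The collars of height \<open>inverse (Suc m)\<close> are open in the whole space and
  shrink to \<open>B\<close>; injectivity of \<open>h\<close> ensures that no other point survives
  in all of them.\<close>

lemma gdelta_in_collar:
  assumes B: "B \<subseteq> topspace X" and h: "is_collar X B h"
  shows "gdelta_in X B"
proof -
  let ?D = "B \<times> {0..1::real}"
  define U where "U m = h ` (B \<times> {0..<inverse (Suc m)})" for m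
  have D: "topspace (collar_domain X B) = ?D"
    using B by auto
  have h0: "\<And>x. x \<in> B \<Longrightarrow> h (x, 0) = x"
    and op: "openin X (h ` (B \<times> {0..<1}))"
    and hom: "homeomorphic_map (collar_domain X B) (subtopology X (h ` ?D)) h"
    using h unfolding is_collar_def embedding_map_def D by blast+
  have inj: "inj_on h ?D"
    using hom D by (metis homeomorphic_imp_injective_map)
  have le1: "inverse (real (Suc m)) \<le> 1" for m
    by (simp add: field_simps)
  have sub: "B \<times> {0..<inverse (real (Suc m))} \<subseteq> ?D" for m
    using le1[of m] by auto
  have "openin X (U m)" for m
  proof -
    have "{0..<inverse (real (Suc m))} = {0..1} \<inter> {..<inverse (real (Suc m))}"
      using le1[of m] by auto
    then have "openin (top_of_set {0..1}) {0..<inverse (real (Suc m))}"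
      by (metis open_lessThan openin_open_Int)
    then have "openin (collar_domain X B) (B \<times> {0..<inverse (real (Suc m))})"
      using B by (simp add: openin_prod_Times_iff openin_subtopology_refl)
    then have "openin (subtopology X (h ` ?D)) (U m)"
      unfolding U_def using hom sub D homeomorphic_map_openness by metis
    then obtain T where T: "openin X T" "U m = T \<inter> h ` ?D"
      unfolding openin_subtopology by blast
    \<comment> \<open>So far \<open>U m\<close> is open only relative to \<open>h\<close>
      ?D\<open>, which need not be open. As it lies inside the open set\<close>h
      \<open>(B \<times> {0..<1})\<close>, cutting \<open>T\<close> down to that set gives openness
      in \<open>X\<close>.\<close>
    have "U m \<subseteq> h ` (B \<times> {0..<1})" "h ` (B \<times> {0..<1}) \<subseteq> h ` ?D"
      unfolding U_def using le1[of m] by (intro image_mono; auto)+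
    with T have "U m = T \<inter> h ` (B \<times> {0..<1})"
      by blast
    then show ?thesis
      using T op by auto
  qed
  then have "gdelta_in X (\<Inter>(range U))"
    by (intro gdelta_in_Inter) (auto intro: open_imp_gdelta_in)
  moreover have "\<Inter>(range U) = B"
  proof (intro subset_antisym subsetI)
    fix x assume x: "x \<in> \<Inter>(range U)"
    then obtain p where p: "p \<in> B \<times> {0..<inverse (real (Suc 0))}" "x = h p"
      unfolding U_def by blast
    \<comment> \<open>The preimage found for each \<open>m\<close> is the same point
      \<open>p\<close>, by injectivity, so its parameter lies below every
      \<open>inverse (Suc m)\<close>.\<close>
    have "snd p < inverse (real (Suc m))" for m
    proof -
      obtain q where q: "q \<in> B \<times> {0..<inverse (real (Suc m))}" "x = h q"
        using x unfolding U_def by blast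
      then have "p = q"
        using p q sub inj unfolding inj_on_def by blast
      then show ?thesis
        using q by auto
    qed
    moreover have "snd p \<ge> 0"
      using p by auto
    ultimately have "snd p = 0"
      by (metis reals_Archimedean less_eq_real_def not_less_iff_gr_or_eq)
    then show "x \<in> B"
      using p h0 by auto
  next
    fix x assume "x \<in> B"
    then show "x \<in> \<Inter>(range U)"
      unfolding U_def using h0 by (auto intro!: image_eqI[where x="(x, 0)"])
  qed
  ultimately show ?thesis
    by simp
qed

subsection \<open>Zero sets with metrisable complement\<close>

text \<open>Balls of radius \<open>inverse (Suc m)\<close> about a countable dense set form a base:
  a centre within less than \<open>r / 2\<close> of \<open>y\<close> gives such a ball around
  \<open>y\<close> inside \<open>mball y r\<close>.\<close>

lemma (in Metric_space) separable_imp_second_countable: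
  assumes "separable_space mtopology"
  shows "second_countable mtopology"
proof -
  obtain D where D: "countable D" "D \<subseteq> M" "mtopology closure_of D = M"
    using assms unfolding separable_space_def by auto
  define \<B> where "\<B> = (\<lambda>(x, m). mball x (inverse (real (Suc m)))) ` (D \<times> UNIV)"
  have "\<exists>V\<in>\<B>. y \<in> V \<and> V \<subseteq> U" if U: "openin mtopology U" "y \<in> U" for U y
  proof -
    obtain r where r: "r > 0" "mball y r \<subseteq> U" and "y \<in> M"
      using U openin_mtopology by blast
    obtain m where m: "inverse (real (Suc m)) < r / 2"
      using reals_Archimedean[of "r/2"] r by auto
    have "y \<in> mtopology closure_of D"
      using D \<open>y \<in> M\<close> by auto
    then have "\<exists>x\<in>D. x \<in> mball y (inverse (real (Suc m)))"
      unfolding metric_closure_of using inverse_Suc by blast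
    then obtain x where x: "x \<in> D" "x \<in> mball y (inverse (real (Suc m)))"
      by blast
    then have "y \<in> mball x (inverse (real (Suc m)))"
      by (auto simp: commute)
    moreover have "mball x (inverse (real (Suc m))) \<subseteq> mball y r"
      using x m by (intro mball_subset) (auto simp: commute)
    ultimately show ?thesis
      unfolding \<B>_def using r x by (intro bexI[of _ "mball x (inverse (real (Suc m)))"]) auto
  qed
  moreover have "countable \<B>" "\<forall>V\<in>\<B>. openin mtopology V"
    unfolding \<B>_def using D by auto
  ultimately show ?thesis
    unfolding second_countable_def by blast
qed

lemma metrizable_separable_imp_Lindelof_space:
  assumes "metrizable_space X" "separable_space X"
  shows "Lindelof_space X"
  using assms Metric_space.separable_imp_second_countable second_countable_imp_Lindelof_space
  unfolding metrizable_space_def by blast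

text \<open>A countable set containing \<open>p\<close> with clopen closure suffices, since a clopen
  set that meets a component contains it. Local separability allows such a set to be generated from
  \<open>p\<close> in countably many steps.\<close>

lemma (in Metric_space) component_subset_closure_of_countable:
  assumes loc: "\<And>y. y \<in> M \<Longrightarrow> \<exists>W. openin mtopology W \<and> y \<in> W \<and> separable_space (subtopology mtopology W)"
    and p: "p \<in> M"
  obtains D where "countable D" "D \<subseteq> M" "connected_component_of_set mtopology p \<subseteq> mtopology closure_of D"
proof -
  \<comment> \<open>\<open>E\<close> need not lie in the ball: any countable set with the ball in
    its closure will do, such as a dense subset of a separable open set around the ball.\<close>
  define good where "good x m E \<longleftrightarrow> countable E \<and> E \<subseteq> M \<and>
      mball x (inverse (real (Suc m))) \<subseteq> mtopology closure_of E" for x m E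
  \<comment> \<open>The choice depends on \<open>x\<close> and \<open>m\<close> alone, so each point
    has only countably many successors; the default \<open>{}\<close> keeps \<open>e x m\<close>
    countable when no good set exists.\<close>
  define e where "e x m = (if \<exists>E. good x m E then SOME E. good x m E else {})" for x m
  have e: "good x m (e x m)" if "good x m E" for x m E
    unfolding e_def using that by (auto intro: someI)
  have e': "countable (e x m)" "e x m \<subseteq> M" for x m
    using e[of x m] unfolding good_def by (cases "\<exists>E. good x m E"; auto simp: e_def good_def)+
  \<comment> \<open>\<open>D\<close> contains \<open>p\<close> and, with each point, countable dense subsets of all its small balls
    that are separable; this makes the closure of \<open>D\<close> open.\<close>
  define R where "R = {(x, z). \<exists>m. z \<in> e x m}"
  define D where "D = R\<^sup>* `` {p}"
  have "R `` Y = (\<Union>x\<in>Y. \<Union>m. e x m)" for Y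
    unfolding R_def by auto
  then have "countable D"
    unfolding D_def by (intro countable_rtrancl) (auto simp: e')
  have "D \<subseteq> M"
  proof
    fix z assume "z \<in> D"
    then have "(p, z) \<in> R\<^sup>*"
      unfolding D_def by auto
    then show "z \<in> M"
      by induction (use p e'(2) in \<open>auto simp: R_def subset_iff\<close>)
  qed
  have eD: "e x m \<subseteq> D" if "x \<in> D" for x m
    using that unfolding D_def R_def by (auto intro: rtrancl_into_rtrancl)
  let ?K = "mtopology closure_of D"
  \<comment> \<open>A point \<open>x\<close> of \<open>D\<close> close to \<open>y\<close> has a
    ball that contains \<open>y\<close> and fits into a separable neighbourhood of \<open>y\<close>.
    That ball lies in the closure of \<open>e x m\<close>, and \<open>e x m\<close> is part of
    \<open>D\<close>.\<close>
  have "\<exists>U. openin mtopology U \<and> y \<in> U \<and> U \<subseteq> ?K" if y: "y \<in> ?K" for y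
  proof -
    have "y \<in> M"
      using y closure_of_subset_topspace[of mtopology D] by auto
    then obtain W where W: "openin mtopology W" "y \<in> W" "separable_space (subtopology mtopology W)"
      using loc by blast
    have tW: "topspace (subtopology mtopology W) = W"
      by (rule topspace_subtopology_subset[OF openin_subset[OF W(1)]])
    obtain E where E: "countable E" "E \<subseteq> W" "subtopology mtopology W closure_of E = W"
      using W(3) unfolding separable_space_def tW by blast
    have WE: "W \<subseteq> mtopology closure_of E"
      using E(3) closure_of_subtopology_subset[of mtopology W E] by simp
    obtain r where r: "r > 0" "mball y r \<subseteq> W"
      using W openin_mtopology by blast
    obtain m where m: "inverse (real (Suc m)) < r / 2"
      using reals_Archimedean[of "r/2"] r by auto
    have "\<exists>x\<in>D. x \<in> mball y (inverse (real (Suc m)))"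
      using y unfolding metric_closure_of using inverse_Suc by blast
    then obtain x where x: "x \<in> D" "x \<in> mball y (inverse (real (Suc m)))"
      by blast
    have "mball x (inverse (real (Suc m))) \<subseteq> mball y r"
      using x m by (intro mball_subset) (auto simp: commute)
    then have "good x m E"
      unfolding good_def using E(1,2) r(2) WE openin_subset[OF W(1)] by auto
    then have "mball x (inverse (real (Suc m))) \<subseteq> mtopology closure_of (e x m)"
      using e unfolding good_def by blast
    also have "\<dots> \<subseteq> ?K"
      using eD x by (intro closure_of_mono)
    finally show ?thesis
      using x by (intro exI[of _ "mball x (inverse (real (Suc m)))"]) (auto simp: commute)
  qed
  then have "openin mtopology ?K"
    by (subst openin_subopen) blast
  moreover have "closedin mtopology ?K"
    by simp
  moreover have "p \<in> ?K"
    using \<open>D \<subseteq> M\<close> closure_of_subset[of D mtopology] unfolding D_def by auto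
  then have "connected_component_of_set mtopology p \<inter> ?K \<noteq> {}"
    using p connected_component_of_refl[of mtopology p] by auto
  ultimately have "connected_component_of_set mtopology p \<subseteq> ?K"
    using connectedin_connected_component_of connectedin_clopen_cases
    by (metis Int_commute disjnt_def)
  with that \<open>countable D\<close> \<open>D \<subseteq> M\<close> show ?thesis
    by blast
qed

lemma Lindelof_space_connected_component:
  assumes X: "metrizable_space X"
    and loc: "\<And>y. y \<in> topspace X \<Longrightarrow> \<exists>W. openin X W \<and> y \<in> W \<and> separable_space (subtopology X W)"
    and op: "openin X (connected_component_of_set X p)"
  shows "Lindelof_space (subtopology X (connected_component_of_set X p))"
proof (cases "p \<in> topspace X")
  case False
  then have "connected_component_of_set X p = {}"
    by (metis connected_component_of_eq_empty)
  then show ?thesis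
    by (intro Lindelof_space_topspace_empty) auto
next
  case True
  obtain M d where d: "Metric_space M d" "X = Metric_space.mtopology M d"
    using X unfolding metrizable_space_def by blast
  let ?C = "connected_component_of_set X p"
  obtain D where D: "countable D" "D \<subseteq> topspace X" "?C \<subseteq> X closure_of D"
    using Metric_space.component_subset_closure_of_countable[OF d(1)] loc True
    unfolding d(2) by (metis Metric_space.topspace_mtopology d(1))
  \<comment> \<open>Openness of the component is what lets \<open>D\<close> be replaced by its trace
    on the component without losing density.\<close>
  have "?C \<subseteq> X closure_of (?C \<inter> D)"
    using D(3) op by (metis Int_absorb2 Int_commute openin_Int_closure_of_subset)
  then have "(subtopology X ?C) closure_of (?C \<inter> D) = ?C"
    using closure_of_subtopology_open[of X ?C "?C \<inter> D"] op by auto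
  moreover have "topspace (subtopology X ?C) = ?C"
    by (rule topspace_subtopology_subset[OF openin_subset[OF op]])
  ultimately have "separable_space (subtopology X ?C)"
    unfolding separable_space_def using D(1) by (intro exI[of _ "?C \<inter> D"] conjI) (simp_all only: countable_Int2 Int_lower1)
  then show ?thesis
    using X metrizable_separable_imp_Lindelof_space metrizable_space_subtopology by blast
qed

section \<open>Zero sets in completely regular spaces and gluing along components\<close>

text \<open>The sum of the \<open>u k\<close> with weights \<open>(1/2) ^ k\<close> converges
  uniformly by the Weierstrass test, hence is continuous; its terms are nonnegative, so it vanishes
  exactly where all of them do.\<close>

lemma zero_set_in_countable_Inter:
  fixes u :: "nat \<Rightarrow> 'a \<Rightarrow> real"
  assumes u: "\<And>k. continuous_map X (top_of_set {0..1}) (u k)"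
  shows "zero_set_in X {x \<in> topspace X. \<forall>k. u k x = 0}"
proof -
  have cont: "continuous_map X euclideanreal (u k)" for k
    using u continuous_map_in_subtopology by blast
  have u01: "0 \<le> u k x" "u k x \<le> 1" if "x \<in> topspace X" for k x
    using u[of k] that unfolding continuous_map_in_subtopology by auto
  let ?t = "\<lambda>k x. (1/2) ^ k * u k x"
  define f where "f x = (\<Sum>k. ?t k x)" for x
  have bound: "norm (?t k x) \<le> (1/2) ^ k" if "x \<in> topspace X" for k x
    using u01[OF that, of k] by (simp add: mult_le_cancel_left1)
  have summ: "summable (\<lambda>k. (1/2::real) ^ k)"
    by simp
  have "uniform_limit (topspace X) (\<lambda>m x. \<Sum>k<m. ?t k x) f sequentially"
    unfolding f_def using bound summ by (rule Weierstrass_m_test)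
  moreover have "continuous_map X euclideanreal (\<lambda>x. \<Sum>k<m. ?t k x)" for m
    by (intro continuous_intros cont) auto
  ultimately have "continuous_map X euclideanreal f"
    using Met_TC.continuous_map_uniform_limit[of X "\<lambda>m x. \<Sum>k<m. ?t k x" sequentially f]
    unfolding uniform_limit_iff by simp
  moreover have "f x = 0 \<longleftrightarrow> (\<forall>k. u k x = 0)" if x: "x \<in> topspace X" for x
  proof -
    have "summable (\<lambda>k. ?t k x)"
      using summ by (rule summable_comparison_test') (rule bound[OF x])
    then show ?thesis
      unfolding f_def using u01[OF x] by (subst suminf_eq_zero_iff) auto
  qed
  ultimately show ?thesis
    unfolding zero_set_in_def by blast
qed

text \<open>Complete regularity covers \<open>C\<close> by sets on which a continuous function
  supported in \<open>C\<close> is nonzero. Countably many suffice by the Lindelof property, and the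
  complement of \<open>C\<close> is the common zero set of their functions.\<close>

lemma zero_set_in_complement_Lindelof_open:
  assumes X: "completely_regular_space X" and C: "openin X C"
    and L: "Lindelof_space (subtopology X C)"
  shows "zero_set_in X (topspace X - C)"
proof (cases "C = {}")
  case True
  then show ?thesis
    unfolding zero_set_in_def by (intro exI[of _ "\<lambda>_. 0"]) auto
next
  case False
  have "C \<subseteq> topspace X"
    using C openin_subset by blast
  have "\<exists>f. continuous_map X (top_of_set {0..1::real}) f \<and> f y = 1 \<and> f ` (topspace X - C) \<subseteq> {0}"
    if "y \<in> C" for y
  proof -
    have "closedin X (topspace X - C) \<and> y \<in> topspace X - (topspace X - C)"
      using C that \<open>C \<subseteq> topspace X\<close> by auto
    \<comment> \<open>Complete regularity yields the value 0 at the point and 1 on the closed set;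
      \<open>1 - g\<close> exchanges the two.\<close>
    then obtain g where g: "continuous_map X (top_of_set {0..1::real}) g" "g y = 0" "g ` (topspace X - C) \<subseteq> {1}"
      using X unfolding completely_regular_space_def by meson
    then have "continuous_map X euclideanreal (\<lambda>x. 1 - g x)" "\<forall>x\<in>topspace X. g x \<in> {0..1}"
      by (auto simp: continuous_map_in_subtopology intro!: continuous_intros)
    then have "continuous_map X (top_of_set {0..1}) (\<lambda>x. 1 - g x)"
      by (simp add: continuous_map_in_subtopology image_subset_iff_funcset[symmetric] image_subset_iff)
    with g show ?thesis
      by (intro exI[of _ "\<lambda>x. 1 - g x"]) (auto simp: image_subset_iff)
  qed
  then obtain f where f: "\<And>y. y \<in> C \<Longrightarrow> continuous_map X (top_of_set {0..1::real}) (f y)"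
    "\<And>y. y \<in> C \<Longrightarrow> f y y = 1" "\<And>y x. y \<in> C \<Longrightarrow> x \<in> topspace X - C \<Longrightarrow> f y x = 0"
    by (metis image_subset_iff singletonD)
  define V where "V y = {x \<in> topspace X. f y x \<in> - {0}}" for y
  have "openin X (V y)" if "y \<in> C" for y
    unfolding V_def using f(1)[OF that]
    by (intro openin_continuous_map_preimage[where Y = euclideanreal])
       (auto simp: continuous_map_in_subtopology)
  moreover have "C \<subseteq> \<Union>(V ` C)"
    unfolding V_def using f(2) \<open>C \<subseteq> topspace X\<close> by fastforce
  ultimately obtain \<V> where \<V>: "countable \<V>" "\<V> \<subseteq> V ` C" "C \<subseteq> \<Union>\<V>"
    using L[unfolded Lindelof_space_subtopology_subset[OF \<open>C \<subseteq> topspace X\<close>], rule_format, of "V ` C"]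
    by blast
  then obtain Y where Y: "countable Y" "Y \<subseteq> C" "C \<subseteq> \<Union>(V ` Y)"
    by (metis countable_subset_image)
  with False have "Y \<noteq> {}"
    by auto
  define u where "u k = f (from_nat_into Y k)" for k
  have Yk: "from_nat_into Y k \<in> C" for k
    using Y from_nat_into[OF \<open>Y \<noteq> {}\<close>] by blast
  have "zero_set_in X {x \<in> topspace X. \<forall>k. u k x = 0}"
    by (rule zero_set_in_countable_Inter) (simp add: u_def f Yk)
  moreover have "{x \<in> topspace X. \<forall>k. u k x = 0} = topspace X - C"
  proof (intro subset_antisym subsetI)
    fix x assume x: "x \<in> {x \<in> topspace X. \<forall>k. u k x = 0}"
    have "x \<notin> V y" if "y \<in> Y" for y
    proof -
      obtain k where "from_nat_into Y k = y"
        using Y(1) \<open>y \<in> Y\<close> from_nat_into_surj by metis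
      then show ?thesis
        using x unfolding u_def V_def by auto
    qed
    then show "x \<in> topspace X - C"
      using x Y(3) by blast
  qed (use f(3) Yk in \<open>auto simp: u_def\<close>)
  ultimately show ?thesis
    by simp
qed

text \<open>The topological core of part (b): the manifold enters only through \<open>conn\<close>
  and \<open>sep\<close>. Applied off \<open>B\<close>, \<open>conn\<close> makes the components of
  the complement open; applied on \<open>B\<close>, it gives continuity of the glued function
  there.\<close>

lemma zero_set_in_metrizable_complement:
  assumes X: "completely_regular_space X" and B: "closedin X B"
    and met: "metrizable_space (subtopology X (topspace X - B))"
    and conn: "\<And>x. x \<in> topspace X \<Longrightarrow> \<exists>W. openin X W \<and> x \<in> W \<and> connectedin X (W - B)"
    and sep: "\<And>x. x \<in> topspace X - B \<Longrightarrow> \<exists>W. openin X W \<and> x \<in> W \<and> separable_space (subtopology X W)"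
  shows "zero_set_in X B"
proof -
  define N where "N = topspace X - B"
  let ?N = "subtopology X N"
  let ?C = "connected_component_of_set ?N"
  have opN: "openin X N"
    unfolding N_def using B by auto
  have tN: "topspace ?N = N"
    using opN openin_subset by fastforce
  \<comment> \<open>A connected trace \<open>W - B\<close> cannot touch two components.\<close>
  have WC: "W - B \<subseteq> ?C y" if "openin X W" "connectedin X (W - B)" "y \<in> W - B" for W y
  proof -
    have "connectedin ?N (W - B)"
      using that openin_subset unfolding connectedin_subtopology N_def by fastforce
    then show ?thesis
      using that connected_component_of_maximal by metis
  qed
  have Copen: "openin ?N (?C p)" for p
  proof (subst openin_subopen, intro ballI)
    fix y assume y: "y \<in> ?C p"
    then have "y \<in> N"
      using connected_component_of_subset_topspace[of ?N p] tN by blast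
    then obtain W where W: "openin X W" "y \<in> W" "connectedin X (W - B)"
      using conn unfolding N_def by blast
    then have "W - B \<subseteq> ?C p"
      using WC[of W y] y \<open>y \<in> N\<close> unfolding N_def
      by (metis DiffD2 DiffI connected_component_of_equiv mem_Collect_eq)
    moreover have "W - B = W \<inter> N"
      using W openin_subset unfolding N_def by fastforce
    ultimately show "\<exists>T. openin ?N T \<and> y \<in> T \<and> T \<subseteq> ?C p"
      using W \<open>y \<in> N\<close> by (metis IntI openin_subtopology_Int)
  qed
  then have CopenX: "openin X (?C p)" for p
    using opN openin_open_subtopology by blast
  have CN: "?C p \<subseteq> N" for p
    using connected_component_of_subset_topspace[of ?N p] tN by blast
  have "zero_set_in X (topspace X - ?C p)" for p
  proof (rule zero_set_in_complement_Lindelof_open[OF X CopenX])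
    have "Lindelof_space (subtopology ?N (?C p))"
    proof (rule Lindelof_space_connected_component)
      fix y assume "y \<in> topspace ?N"
      then have "y \<in> topspace X - B"
        using tN N_def by blast
      then obtain W where W: "openin X W" "y \<in> W" "separable_space (subtopology X W)"
        using sep by blast
      have "separable_space (subtopology (subtopology X W) (W \<inter> N))"
        using W(3) openin_subtopology_Int2[OF opN] by (rule separable_space_open_subset)
      then have "separable_space (subtopology ?N (W \<inter> N))"
        by (simp add: subtopology_subtopology Int_ac)
      then show "\<exists>W. openin ?N W \<and> y \<in> W \<and> separable_space (subtopology ?N W)"
        using W \<open>y \<in> topspace ?N\<close> tN by (metis IntI openin_subtopology_Int)
    qed (use met Copen N_def in auto)
    then show "Lindelof_space (subtopology X (?C p))"
      using CN[of p] by (simp add: subtopology_subtopology Int_absorb1)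
  qed
  \<comment> \<open>The functions are chosen for components as sets, not for points
    \<open>p\<close>, so two points of one component share the same function.\<close>
  then have "\<forall>Q\<in>range ?C. \<exists>f. continuous_map X euclideanreal f \<and> topspace X - Q = {x \<in> topspace X. f x = 0}"
    unfolding zero_set_in_def by blast
  then obtain f where "\<forall>Q\<in>range ?C. continuous_map X euclideanreal (f Q) \<and> topspace X - Q = {x \<in> topspace X. f Q x = 0}"
    by (rule bchoice[THEN exE])
  then have f: "\<And>p. continuous_map X euclideanreal (f (?C p))"
     "\<And>p. topspace X - ?C p = {x \<in> topspace X. f (?C p) x = 0}"
    by simp_all
  define g where "g x = (if x \<in> B then 0 else f (?C x) x)" for x
  obtain W where W: "\<And>x. x \<in> topspace X \<Longrightarrow> openin X (W x) \<and> x \<in> W x \<and> connectedin X (W x - B)"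
    using conn by metis
  have loc: "\<exists>h. continuous_map X euclideanreal h \<and> (\<forall>z\<in>W x. g z = h z)" if x: "x \<in> topspace X" for x
  proof (cases "W x - B = {}")
    case True
    then show ?thesis
      by (intro exI[of _ "\<lambda>_. 0"]) (auto simp: g_def)
  next
    case False
    then obtain y where y: "y \<in> W x - B"
      by blast
    \<comment> \<open>One function serves all of \<open>W x\<close>: off \<open>B\<close> every
      point lies in the component of \<open>y\<close>, and on \<open>B\<close> both sides vanish
      because the component avoids \<open>B\<close>.\<close>
    have "g z = f (?C y) z" if "z \<in> W x" for z
    proof (cases "z \<in> B")
      case True
      then have "z \<in> topspace X - ?C y"
        using CN[of y] W[OF x] \<open>z \<in> W x\<close> openin_subset unfolding N_def by fastforce
      then show ?thesis
        using f(2)[of y] True by (auto simp: g_def)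
    next
      case False
      then have "z \<in> ?C y"
        using WC W x y that by blast
      then have "?C z = ?C y"
        using connected_component_of_equiv[of ?N y z] by auto
      then show ?thesis
        using False by (simp add: g_def)
    qed
    then show ?thesis
      using f(1) by blast
  qed
  then obtain h where h: "\<And>x. x \<in> topspace X \<Longrightarrow> continuous_map X euclideanreal (h x)"
     "\<And>x z. x \<in> topspace X \<Longrightarrow> z \<in> W x \<Longrightarrow> g z = h x z"
    by metis
  have "continuous_map X euclideanreal g"
  proof (rule pasting_lemma[where I = "topspace X" and T = W and f = h])
    show "\<exists>j. j \<in> topspace X \<and> x \<in> W j \<and> g x = h j x" if "x \<in> topspace X" for x
      using that h W by blast
    show "h i x = h j x" if "i \<in> topspace X" "j \<in> topspace X" "x \<in> topspace X \<inter> W i \<inter> W j" for i j x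
      using that h(2) by (metis IntD1 IntD2)
  qed (use h W in \<open>auto intro: continuous_map_from_subtopology\<close>)
  moreover have "g x = 0 \<longleftrightarrow> x \<in> B" if "x \<in> topspace X" for x
  proof -
    have "x \<in> ?C x" if "x \<notin> B"
      using that \<open>x \<in> topspace X\<close> tN unfolding N_def
      by (simp add: connected_component_of_refl)
    then show ?thesis
      using f(2)[of x] that by (auto simp: g_def)
  qed
  then have "B = {x \<in> topspace X. g x = 0}"
    using B closedin_subset by fastforce
  ultimately show ?thesis
    unfolding zero_set_in_def by blast
qed

subsection \<open>Boxes in the half-space and in manifolds\<close>

lemma Euclidean_space_eq_top_of_set: "Euclidean_space n = top_of_set {x. \<forall>i\<ge>n. x i = 0}"
  by (simp add: Euclidean_space_def euclidean_product_topology)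

lemma half_space_eq_top_of_set: "half_space n = top_of_set ({x. \<forall>i\<ge>n - 1. x i = 0} \<times> {0..})"
  by (simp add: half_space_def Euclidean_space_eq_top_of_set)

text \<open>With \<open>J\<close> left free, one formula covers both the neighbourhood of a boundary
  point, where \<open>J\<close> may reach below 0 and is cut off, and the box inside it whose last
  coordinate stays positive. The zero tail matches the encoding of \<open>Euclidean_space\<close> by
  sequences.\<close>

definition half_space_box :: "nat \<Rightarrow> (nat \<Rightarrow> real) \<Rightarrow> real \<Rightarrow> real set \<Rightarrow> ((nat \<Rightarrow> real) \<times> real) set" where
  "half_space_box n a \<epsilon> J =
     {p. (\<forall>i<n - 1. \<bar>fst p i - a i\<bar> < \<epsilon>) \<and> (\<forall>i\<ge>n - 1. fst p i = 0) \<and> 0 \<le> snd p \<and> snd p \<in> J}"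

lemma openin_half_space_box:
  assumes "open J"
  shows "openin (half_space n) (half_space_box n a \<epsilon> J)"
proof -
  have "open (\<Inter>i\<in>{..<n - 1}. {p :: (nat \<Rightarrow> real) \<times> real. \<bar>fst p i - a i\<bar> < \<epsilon>})"
    by (intro open_INT ballI open_Collect_less continuous_intros
        continuous_on_compose2[OF continuous_on_product_coordinates]) auto
  moreover have "open {p :: (nat \<Rightarrow> real) \<times> real. snd p \<in> J}"
    using open_vimage_snd[OF assms] by (simp add: vimage_def)
  ultimately have "open ((\<Inter>i\<in>{..<n - 1}. {p. \<bar>fst p i - a i\<bar> < \<epsilon>}) \<inter> {p :: (nat \<Rightarrow> real) \<times> real. snd p \<in> J})"
    by (rule open_Int)
  moreover have "half_space_box n a \<epsilon> J = ({x. \<forall>i\<ge>n - 1. x i = 0} \<times> {0..}) \<inter>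
     ((\<Inter>i\<in>{..<n - 1}. {p. \<bar>fst p i - a i\<bar> < \<epsilon>}) \<inter> {p. snd p \<in> J})"
    unfolding half_space_box_def by auto
  ultimately show ?thesis
    unfolding half_space_eq_top_of_set openin_open by blast
qed

text \<open>The shrinking map \<open>s\<close> takes the line onto the interval from -1 to 1, with
  inverse \<open>g\<close>; rescaling it in each coordinate gives the box. As
  \<open>0 \<le> l\<close>, the cut-off at 0 removes nothing.\<close>

lemma half_space_box_homeomorphic:
  assumes n: "n \<ge> 1" and \<epsilon>: "\<epsilon> > 0" and lr: "0 \<le> l" "l < r"
  shows "subtopology (half_space n) (half_space_box n a \<epsilon> {l<..<r}) homeomorphic_space Euclidean_space n"
proof -
  define s where "s t = t / (1 + \<bar>t\<bar>)" for t :: real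
  define g where "g t = t / (1 - \<bar>t\<bar>)" for t :: real
  have s: "\<bar>s t\<bar> < 1" "g (s t) = t" for t
    using real_shrink_Galois[of t "s t"] unfolding s_def g_def by auto
  have g: "s (g t) = t" if "\<bar>t\<bar> < 1" for t
    using real_shrink_Galois[of "g t" t] that unfolding s_def g_def by auto
  have cs: "continuous_on UNIV s"
    unfolding s_def by (rule continuous_shrink)
  have cg: "continuous_on {t. \<bar>t\<bar> < 1} g"
    unfolding g_def by (intro continuous_intros) auto
  let ?E = "{x :: nat \<Rightarrow> real. \<forall>i\<ge>n. x i = 0}"
  let ?I = "half_space_box n a \<epsilon> {l<..<r}"
  define m d where "m = (l + r) / 2" and "d = (r - l) / 2"
  have d: "d > 0" and md: "l = m - d" "r = m + d"
    using lr by (auto simp: m_def d_def field_simps)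
  \<comment> \<open>Index \<open>n - 1\<close> of the sequence carries the separate last coordinate
    of the half-space; it is a genuine coordinate because \<open>n \<ge> 1\<close>.\<close>
  define F where "F y = ((\<lambda>i. if i < n - 1 then a i + \<epsilon> * s (y i) else 0), m + d * s (y (n - 1)))"
    for y :: "nat \<Rightarrow> real"
  define G where "G p = (\<lambda>i. if i < n - 1 then g ((fst p i - a i) / \<epsilon>)
      else if i = n - 1 then g ((snd p - m) / d) else 0)" for p :: "(nat \<Rightarrow> real) \<times> real"
  have small: "\<bar>(snd p - m) / d\<bar> < 1" "i < n - 1 \<Longrightarrow> \<bar>(fst p i - a i) / \<epsilon>\<bar> < 1" if "p \<in> ?I" for p i
    using that d \<epsilon> unfolding half_space_box_def by (auto simp: abs_less_iff field_simps md)
  have "homeomorphism ?I ?E G F"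
  proof (rule homeomorphismI)
    have "continuous_on ?I (\<lambda>p. G p i)" for i
    proof -
      have "continuous_on ?I (\<lambda>p. g ((fst p i - a i) / \<epsilon>))" if "i < n - 1"
        using \<epsilon> small(2) that
        by (intro continuous_on_compose2[OF cg] continuous_intros
            continuous_on_compose2[OF continuous_on_product_coordinates]) auto
      moreover have "continuous_on ?I (\<lambda>p. g ((snd p - m) / d))"
        using d small(1)
        by (intro continuous_on_compose2[OF cg] continuous_intros) auto
      ultimately show ?thesis
        unfolding G_def by (cases "i < n - 1"; cases "i = n - 1") auto
    qed
    then show "continuous_on ?I G"
      by (rule continuous_on_coordinatewise_then_product)
    have "continuous_on ?E (\<lambda>y. s (y i))" for i
      by (intro continuous_on_compose2[OF cs]
          continuous_on_subset[OF continuous_on_product_coordinates]) auto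
    note cont = this
    have "continuous_on ?E (\<lambda>y. if i < n - 1 then a i + \<epsilon> * s (y i) else 0)" for i
      by (cases "i < n - 1") (auto intro!: continuous_intros cont)
    then have "continuous_on ?E (\<lambda>y i. if i < n - 1 then a i + \<epsilon> * s (y i) else 0)"
      by (rule continuous_on_coordinatewise_then_product)
    then show "continuous_on ?E F"
      unfolding F_def
      by (rule continuous_on_Pair) (intro continuous_on_add continuous_on_mult continuous_on_const cont)
    show "G ` ?I \<subseteq> ?E"
      using n unfolding G_def by auto
    show "F ` ?E \<subseteq> ?I"
    proof (intro image_subsetI)
      fix y :: "nat \<Rightarrow> real"
      have "\<bar>\<epsilon> * s (y i)\<bar> < \<epsilon>" for i
        using \<epsilon> s(1)[of "y i"] by (simp add: abs_mult)
      moreover have "\<bar>d * s (y (n - 1))\<bar> < d"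
        using d s(1)[of "y (n - 1)"] by (simp only: abs_mult) auto
      then have "l < m + d * s (y (n - 1))" "m + d * s (y (n - 1)) < r"
        by (auto simp: abs_less_iff md)
      ultimately show "F y \<in> ?I"
        using lr unfolding half_space_box_def F_def by auto
    qed
    show "F (G p) = p" if "p \<in> ?I" for p
    proof -
      have "\<epsilon> * s (g ((fst p i - a i) / \<epsilon>)) = fst p i - a i" if "i < n - 1" for i
        using g[OF small(2)[OF \<open>p \<in> ?I\<close> that]] \<epsilon> by simp
      moreover have "d * s (g ((snd p - m) / d)) = snd p - m"
        using g[OF small(1)[OF that]] d by simp
      ultimately show ?thesis
        using that unfolding F_def G_def half_space_box_def by (auto simp: prod_eq_iff fun_eq_iff)
    qed
    show "G (F y) = y" if "y \<in> ?E" for y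
      using that d \<epsilon> n unfolding F_def G_def by (auto simp: fun_eq_iff s)
  qed
  then have "top_of_set ?I homeomorphic_space top_of_set ?E"
    unfolding homeomorphic_space_def homeomorphic_maps_def homeomorphism_def
    by (intro exI[of _ G] exI[of _ F]) (auto simp: continuous_map_in_subtopology)
  moreover have "subtopology (half_space n) ?I = top_of_set ?I"
    unfolding half_space_eq_top_of_set subtopology_subtopology half_space_box_def
    by (rule arg_cong[where f = top_of_set]) auto
  ultimately show ?thesis
    by (simp add: Euclidean_space_eq_top_of_set)
qed

text \<open>All coordinates from \<open>n - 1\<close> on are fixed at 0 in the half-space, so a
  product neighbourhood restricts only finitely many and one radius serves them all.\<close>

lemma half_space_box_subset_open:
  assumes V: "openin (half_space n) V" and x: "x \<in> V"
  obtains \<epsilon> where "\<epsilon> > 0" "half_space_box n (fst x) \<epsilon> {snd x - \<epsilon><..<snd x + \<epsilon>} \<subseteq> V"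
proof -
  obtain T where T: "open T" "V = ({x. \<forall>i\<ge>n - 1. x i = 0} \<times> {0..}) \<inter> T"
    using V unfolding half_space_eq_top_of_set openin_open by blast
  then obtain P Q where PQ: "open P" "open Q" "x \<in> P \<times> Q" "P \<times> Q \<subseteq> T"
    using x open_prod_elim[OF T(1), of x] by auto
  have "openin (product_topology (\<lambda>i. euclideanreal) UNIV) P"
    using PQ(1) by (simp add: euclidean_product_topology)
  then obtain X where X: "fst x \<in> (\<Pi>\<^sub>E i\<in>UNIV. X i)" "\<And>i. open (X i)" "(\<Pi>\<^sub>E i\<in>UNIV. X i) \<subseteq> P"
    using product_topology_open_contains_basis[of "\<lambda>i. euclideanreal" UNIV P "fst x"] PQ(3)
    by auto
  have "\<exists>e>0. ball (fst x i) e \<subseteq> X i" for i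
    using X(1) X(2)[of i] by (auto simp: PiE_iff open_contains_ball)
  then obtain e where e: "\<And>i. e i > 0" "\<And>i. ball (fst x i) (e i) \<subseteq> X i"
    by metis
  obtain e' where e': "e' > 0" "ball (snd x) e' \<subseteq> Q"
    using PQ by (metis mem_Times_iff open_contains_ball)
  \<comment> \<open>Including \<open>e'\<close> bounds the last coordinate and keeps the set
    nonempty when \<open>n = 1\<close>.\<close>
  define \<epsilon> where "\<epsilon> = Min (insert e' (e ` {..<n - 1}))"
  have "\<epsilon> > 0"
    unfolding \<epsilon>_def using e e' by (subst Min_gr_iff) auto
  moreover have le: "\<epsilon> \<le> e'" "\<And>i. i < n - 1 \<Longrightarrow> \<epsilon> \<le> e i"
    unfolding \<epsilon>_def by (auto intro!: Min_le)
  have "half_space_box n (fst x) \<epsilon> {snd x - \<epsilon><..<snd x + \<epsilon>} \<subseteq> V"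
  proof
    fix p assume p: "p \<in> half_space_box n (fst x) \<epsilon> {snd x - \<epsilon><..<snd x + \<epsilon>}"
    have "fst p i \<in> X i" for i
    proof (cases "i < n - 1")
      case True
      then have "fst p i \<in> ball (fst x i) (e i)"
        using p le(2)[OF True] unfolding half_space_box_def by (fastforce simp: dist_real_def)
      then show ?thesis
        using e by blast
    next
      case False
      then have "fst p i = fst x i"
        using p x T(2) unfolding half_space_box_def by auto
      then show ?thesis
        using e(1,2)[of i] by (metis centre_in_ball subsetD)
    qed
    then have "fst p \<in> P"
      using X(3) by (auto simp: PiE_iff)
    moreover have "snd p \<in> Q"
      using p le(1) e'(2) unfolding half_space_box_def by (force simp: dist_real_def)
    ultimately have "p \<in> T"
      using PQ(4) by (metis mem_Times_iff subsetD)
    then show "p \<in> V"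
      using p T(2) unfolding half_space_box_def by (auto simp: mem_Times_iff)
  qed
  ultimately show ?thesis
    using that by blast
qed

text \<open>Any point of the larger box can be pushed up slightly in the last coordinate, which
  takes it off the face at 0 and into the smaller box.\<close>

lemma half_space_box_subset_closure:
  "half_space_box n a \<epsilon> {c - \<epsilon><..<c + \<epsilon>} \<subseteq>
     half_space n closure_of (half_space_box n a \<epsilon> {max 0 (c - \<epsilon>)<..<c + \<epsilon>})"
proof
  fix p assume p: "p \<in> half_space_box n a \<epsilon> {c - \<epsilon><..<c + \<epsilon>}"
  have "\<exists>y \<in> half_space_box n a \<epsilon> {max 0 (c - \<epsilon>)<..<c + \<epsilon>}. y \<in> U"
    if U: "p \<in> U" "openin (half_space n) U" for U
  proof -
    obtain \<delta> where \<delta>: "\<delta> > 0" "half_space_box n (fst p) \<delta> {snd p - \<delta><..<snd p + \<delta>} \<subseteq> U"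
      using half_space_box_subset_open U by metis
    \<comment> \<open>Half of each gap keeps the raised point below both
      \<open>snd p + \<delta>\<close> and \<open>c + \<epsilon>\<close>.\<close>
    define t where "t = snd p + min (\<delta> / 2) ((c + \<epsilon> - snd p) / 2)"
    have t: "snd p < t" "t < snd p + \<delta>" "t < c + \<epsilon>"
      using p \<delta>(1) unfolding t_def half_space_box_def by (auto simp: min_def field_simps)
    then have "(fst p, t) \<in> half_space_box n (fst p) \<delta> {snd p - \<delta><..<snd p + \<delta>}"
      using p \<delta>(1) unfolding half_space_box_def by auto
    moreover have "(fst p, t) \<in> half_space_box n a \<epsilon> {max 0 (c - \<epsilon>)<..<c + \<epsilon>}"
      using p t unfolding half_space_box_def by auto
    ultimately show ?thesis
      using \<delta>(2) by blast
  qed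
  moreover have "p \<in> topspace (half_space n)"
    using p unfolding half_space_eq_top_of_set half_space_box_def by (auto simp: mem_Times_iff)
  ultimately show "p \<in> half_space n closure_of (half_space_box n a \<epsilon> {max 0 (c - \<epsilon>)<..<c + \<epsilon>})"
    unfolding in_closure_of by blast
qed

section \<open>Local compactness and local structure of manifolds\<close>

lemma locally_compact_half_space: "locally_compact_space (half_space n)"
proof -
  have "locally_compact_space (top_of_set {0::real..})"
    by (rule locally_compact_space_closed_subset[OF locally_compact_space_euclidean]) simp
  then show ?thesis
    unfolding half_space_def by (simp add: locally_compact_space_prod_topology locally_compact_Euclidean_space)
qed

lemma separable_space_top_of_set:
  fixes S :: "'a::second_countable_topology set"
  shows "separable_space (top_of_set S)"
proof -
  obtain \<B> :: "'a set set" where \<B>: "countable \<B>" "\<And>C. C \<in> \<B> \<Longrightarrow> openin (top_of_set S) C"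
    "\<And>T. openin (top_of_set S) T \<Longrightarrow> \<exists>\<U>. \<U> \<subseteq> \<B> \<and> T = \<Union>\<U>"
    by (rule subset_second_countable[of S]) blast
  have "\<exists>V\<in>\<B>. x \<in> V \<and> V \<subseteq> U" if "openin (top_of_set S) U" "x \<in> U" for U x
    using \<B>(3)[OF that(1)] that(2) by blast
  then have "second_countable (top_of_set S)"
    unfolding second_countable_def using \<B>(1,2) by blast
  then show ?thesis
    by (rule second_countable_imp_separable_space)
qed

lemma locally_compact_space_manifold:
  assumes "manifold n M"
  shows "locally_compact_space M"
  unfolding locally_compact_space_def
proof
  fix x assume "x \<in> topspace M"
  then obtain A U where A: "A \<subseteq> topspace M" "openin M U" "x \<in> U" "U \<subseteq> A"
    "subtopology M A homeomorphic_space half_space n"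
    using assms unfolding manifold_def neighbourhood_in_def by metis
  then have "locally_compact_space (subtopology M A)"
    using homeomorphic_locally_compact_space locally_compact_half_space by blast
  moreover have "x \<in> topspace (subtopology M A)"
    using A by auto
  ultimately obtain T K where T: "openin (subtopology M A) T" "compactin (subtopology M A) K" "x \<in> T" "T \<subseteq> K"
    unfolding locally_compact_space_def by metis
  then obtain T' where "openin M T'" "T = T' \<inter> A"
    unfolding openin_subtopology by blast
  \<comment> \<open>The chart domain \<open>A\<close> need not be open, so \<open>T\<close> need not
    be open in \<open>M\<close>; intersecting \<open>T'\<close> with the open set \<open>U\<close>
    inside \<open>A\<close> repairs this.\<close>
  then have "openin M (T' \<inter> U)" "x \<in> T' \<inter> U" "T' \<inter> U \<subseteq> K"
    using A(2-4) T(3,4) by blast+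
  then show "\<exists>U K. openin M U \<and> compactin M K \<and> x \<in> U \<and> U \<subseteq> K"
    using T(2) compactin_subtopology by blast
qed

text \<open>An open set is a neighbourhood of each of its points, so the single chart witnesses that
  all of them are interior.\<close>

lemma interior_chart_subset:
  assumes "openin M I" "subtopology M I homeomorphic_space Euclidean_space n"
  shows "I \<subseteq> topspace M - manifold_boundary n M"
  using assms openin_subset[OF assms(1)] unfolding manifold_boundary_def neighbourhood_in_def by blast

lemma closedin_manifold_boundary: "closedin M (manifold_boundary n M)"
proof -
  have "openin M (topspace M - manifold_boundary n M)"
  proof (subst openin_subopen, intro ballI)
    fix x assume "x \<in> topspace M - manifold_boundary n M"
    then obtain A U where A: "A \<subseteq> topspace M" "openin M U" "x \<in> U" "U \<subseteq> A"
      "subtopology M A homeomorphic_space Euclidean_space n"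
      unfolding manifold_boundary_def neighbourhood_in_def by blast
    \<comment> \<open>The same \<open>A\<close> is a Euclidean neighbourhood of every point of
      \<open>U\<close>.\<close>
    then have "U \<subseteq> topspace M - manifold_boundary n M"
      unfolding manifold_boundary_def neighbourhood_in_def by blast
    with A show "\<exists>T. openin M T \<and> x \<in> T \<and> T \<subseteq> topspace M - manifold_boundary n M"
      by blast
  qed
  moreover have "manifold_boundary n M \<subseteq> topspace M"
    unfolding manifold_boundary_def by blast
  ultimately show ?thesis
    unfolding closedin_def by blast
qed

text \<open>Supplies the two local hypotheses of \<open>zero_set_in_metrizable_complement\<close>,
  with the image of one small box serving for both.\<close>

lemma manifold_local_structure:
  assumes n: "n \<ge> 1" and M: "manifold n M" and x: "x \<in> topspace M"
  obtains W where "openin M W" "x \<in> W" "separable_space (subtopology M W)"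
    "connectedin M (W - manifold_boundary n M)"
proof -
  obtain A U where A: "A \<subseteq> topspace M" "openin M U" "x \<in> U" "U \<subseteq> A"
    "subtopology M A homeomorphic_space half_space n"
    using M x unfolding manifold_def neighbourhood_in_def by metis
  obtain \<phi> \<psi> where hm: "homeomorphic_maps (subtopology M A) (half_space n) \<phi> \<psi>"
    using A(5) unfolding homeomorphic_space_def by blast
  have \<phi>: "homeomorphic_map (subtopology M A) (half_space n) \<phi>"
    and \<psi>: "homeomorphic_map (half_space n) (subtopology M A) \<psi>"
    using hm homeomorphic_maps_map by blast+
  have tA: "topspace (subtopology M A) = A"
    using A by auto
  have \<psi>\<phi>: "\<And>z. z \<in> A \<Longrightarrow> \<psi> (\<phi> z) = z"
    using hm unfolding homeomorphic_maps_def tA by blast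
  have "openin (subtopology M A) U"
    using A by (metis inf.absorb1 openin_subtopology_Int)
  then have opU: "openin (half_space n) (\<phi> ` U)"
    using \<phi> homeomorphic_map_openness_eq by blast
  define a c where "a = fst (\<phi> x)" and "c = snd (\<phi> x)"
  obtain \<epsilon> where \<epsilon>: "\<epsilon> > 0" "half_space_box n a \<epsilon> {c - \<epsilon><..<c + \<epsilon>} \<subseteq> \<phi> ` U"
    using half_space_box_subset_open[OF opU] A(3) unfolding a_def c_def by blast
  define W where "W = half_space_box n a \<epsilon> {c - \<epsilon><..<c + \<epsilon>}"
  define I where "I = half_space_box n a \<epsilon> {max 0 (c - \<epsilon>)<..<c + \<epsilon>}"
  have opW: "openin (half_space n) W" and opI: "openin (half_space n) I"
    unfolding W_def I_def by (auto intro: openin_half_space_box)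
  have "I \<subseteq> W"
    unfolding I_def W_def half_space_box_def by auto
  have "\<phi> x \<in> topspace (half_space n)"
    using opU A(3) openin_subset by blast
  then have x0: "\<forall>i\<ge>n - 1. a i = 0" "c \<ge> 0"
    unfolding a_def c_def half_space_eq_top_of_set by auto
  have op: "openin M (\<psi> ` S)" "\<psi> ` S \<subseteq> A"
    and hom: "subtopology (half_space n) S homeomorphic_space subtopology M (\<psi> ` S)"
    if S: "openin (half_space n) S" "S \<subseteq> W" for S
  proof -
    have "\<psi> ` S \<subseteq> U"
      using S(2) \<epsilon>(2) \<psi>\<phi> A(4) unfolding W_def by fastforce
    then show sub: "\<psi> ` S \<subseteq> A"
      using A(4) by blast
    have "openin (subtopology M A) (\<psi> ` S)"
      using \<psi> S(1) homeomorphic_map_openness_eq by blast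
    then obtain T where "openin M T" "\<psi> ` S = T \<inter> A"
      unfolding openin_subtopology by blast
    then have "\<psi> ` S = T \<inter> U"
      using \<open>\<psi> ` S \<subseteq> U\<close> A(4) by blast
    then show "openin M (\<psi> ` S)"
      using \<open>openin M T\<close> A(2) by auto
    have "homeomorphic_map (subtopology (half_space n) S) (subtopology (subtopology M A) (\<psi> ` S)) \<psi>"
      using \<psi> sub tA openin_subset[OF S(1)] by (intro homeomorphic_map_subtopologies) auto
    then show "subtopology (half_space n) S homeomorphic_space subtopology M (\<psi> ` S)"
      using sub homeomorphic_map_imp_homeomorphic_space
      by (fastforce simp: subtopology_subtopology Int_absorb1)
  qed
  \<comment> \<open>The last-coordinate interval of \<open>I\<close> is nonempty since
    \<open>c \<ge> 0\<close>, and it starts at a nonnegative number, so \<open>I\<close> is a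
    Euclidean box.\<close>
  have "max 0 (c - \<epsilon>) < c + \<epsilon>"
    using x0(2) \<epsilon>(1) by auto
  then have "subtopology (half_space n) I homeomorphic_space Euclidean_space n"
    unfolding I_def by (intro half_space_box_homeomorphic n \<epsilon>(1)) auto
  then have homI: "subtopology M (\<psi> ` I) homeomorphic_space Euclidean_space n"
    using hom[OF opI \<open>I \<subseteq> W\<close>] homeomorphic_space_sym homeomorphic_space_trans by blast
  show thesis
  proof
    show "openin M (\<psi> ` W)"
      using op opW by blast
    have "\<phi> x \<in> W"
      using x0 \<epsilon>(1) unfolding W_def half_space_box_def by (auto simp: a_def c_def)
    then show "x \<in> \<psi> ` W"
      using \<psi>\<phi> A(3,4) by (metis image_eqI subsetD)
    have "separable_space (subtopology (half_space n) W)"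
      unfolding half_space_eq_top_of_set subtopology_subtopology by (rule separable_space_top_of_set)
    then show "separable_space (subtopology M (\<psi> ` W))"
      using hom[OF opW] homeomorphic_separable_space by blast
    have sub: "\<psi> ` I \<subseteq> topspace M - manifold_boundary n M"
      using interior_chart_subset op opI \<open>I \<subseteq> W\<close> homI by blast
    \<comment> \<open>Whichever points of \<open>\<psi>\<close> W\<open>belong to the boundary,
      removing them leaves a set between the connected set\<close>\<psi> \<open>I\<close> and its
      closure.\<close>
    show "connectedin M (\<psi> ` W - manifold_boundary n M)"
    proof (rule connectedin_intermediate_closure_of)
      show "connectedin M (\<psi> ` I)"
        using homI sub homeomorphic_connected_space connected_Euclidean_space
        unfolding connectedin_def by blast
      show "\<psi> ` I \<subseteq> \<psi> ` W - manifold_boundary n M"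
        using sub \<open>I \<subseteq> W\<close> by blast
      have "\<psi> ` W \<subseteq> subtopology M A closure_of (\<psi> ` I)"
        using half_space_box_subset_closure[of n a \<epsilon> c] homeomorphic_map_closure_of[OF \<psi>, of I]
          openin_subset[OF opI] unfolding W_def I_def by (metis image_mono)
      also have "\<dots> \<subseteq> M closure_of (\<psi> ` I)"
        using closure_of_subtopology_subset by (metis Int_lower2 op(2)[OF opI \<open>I \<subseteq> W\<close>])
      finally show "\<psi> ` W - manifold_boundary n M \<subseteq> M closure_of (\<psi> ` I)"
        by blast
    qed
  qed
qed

theorem theorem1p3:
  fixes M :: "'a topology" and n :: nat
  assumes "n \<ge> 1"
    and "manifold n M"
  shows "(strongly_collared_in M (manifold_boundary n M) \<longrightarrow> zero_set_in M (manifold_boundary n M)) \<and>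
         (metrizable_space (subtopology M (topspace M - manifold_boundary n M))
            \<longrightarrow> zero_set_in M (manifold_boundary n M)) \<and>
         (collared_in M (manifold_boundary n M) \<longrightarrow> gdelta_in M (manifold_boundary n M))"
proof (intro conjI impI)
  let ?B = "manifold_boundary n M"
  have B: "closedin M ?B" "?B \<subseteq> topspace M"
    by (rule closedin_manifold_boundary, rule closedin_subset[OF closedin_manifold_boundary])
  show "zero_set_in M ?B" if "strongly_collared_in M ?B"
    using that B(2) zero_set_in_closed_collar unfolding strongly_collared_in_def by blast
  show "gdelta_in M ?B" if "collared_in M ?B"
    using that B(2) gdelta_in_collar unfolding collared_in_def by blast
  show "zero_set_in M ?B" if met: "metrizable_space (subtopology M (topspace M - ?B))"
  proof (rule zero_set_in_metrizable_complement[OF _ B(1) met])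
    have "Hausdorff_space M"
      using assms(2) unfolding manifold_def by blast
    then show "completely_regular_space M"
      by (intro locally_compact_regular_imp_completely_regular_space disjI1
          locally_compact_space_manifold[OF assms(2)])
    show "\<exists>W. openin M W \<and> x \<in> W \<and> connectedin M (W - ?B)" if "x \<in> topspace M" for x
      by (rule manifold_local_structure[OF assms that]) blast
    show "\<exists>W. openin M W \<and> x \<in> W \<and> separable_space (subtopology M W)" if "x \<in> topspace M - ?B" for x
      by (rule manifold_local_structure[OF assms, of x]) (use that in blast)+
  qed
qed

end
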